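(* Let $X$ be a crowded Hausdorff topological space. Then its double density spectrum $dd(X)$ is $\omega$-closed.
   Context: A space is crowded if it has no isolated points. The density $d(X)$ of a space $X$ is the minimum cardinality of a dense subspace of $X$. $\mathcal{D}(X)$ denotes the family of all dense subspaces of $X$, and $dd(X)=\{d(D): D\in\mathcal{D}(X)\}$ is the double density spectrum of $X$. A set of cardinals is $\omega$-closed if it contains the supremum of each of its non-empty countable subsets. *)

theory Defs
  imports "HOL-Analysis.Analysis"
begin

unbundle cardinal_syntax

text \<open>
  Cardinals are represented, as in the library, by cardinal orders (\<^const>\<open>Card_order\<close>),
  which are compared by \<open>\<le>o\<close> and identified up to \<open>=o\<close>.  A cardinal order is not unique
  within its \<open>=o\<close>-class, so membership of a cardinal in a set of cardinals always means that
  some representative of it lies in the set.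
\<close>

definition crowded_space :: "'a topology \<Rightarrow> bool" where
  "crowded_space X \<longleftrightarrow> (\<forall>x \<in> topspace X. \<not> openin X {x})"

definition dense_subsets :: "'a topology \<Rightarrow> 'a set set" where
  "dense_subsets X = {D. D \<subseteq> topspace X \<and> X closure_of D = topspace X}"

definition density :: "'a topology \<Rightarrow> 'a rel" where
  "density X = |SOME D. D \<in> dense_subsets X \<and> (\<forall>E \<in> dense_subsets X. |D| \<le>o |E| )|"

definition double_density_spectrum :: "'a topology \<Rightarrow> 'a rel set" where
  "double_density_spectrum X = (\<lambda>D. density (subtopology X D)) ` dense_subsets X"

text \<open>
  The competing upper bounds \<open>t\<close> range over cardinal orders on the same type only; the lemma
  \<open>is_card_sup_least\<close> below shows that this is no restriction.
\<close>

definition is_card_sup :: "'a rel set \<Rightarrow> 'a rel \<Rightarrow> bool" where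
  "is_card_sup S k \<longleftrightarrow> Card_order k \<and> (\<forall>s \<in> S. s \<le>o k) \<and>
     (\<forall>t :: 'a rel. Card_order t \<and> (\<forall>s \<in> S. s \<le>o t) \<longrightarrow> k \<le>o t)"

definition omega_closed :: "'a rel set \<Rightarrow> bool" where
  "omega_closed R \<longleftrightarrow> (\<forall>S \<subseteq> R. S \<noteq> {} \<and> countable S \<longrightarrow> (\<exists>k \<in> R. is_card_sup S k))"

lemma density_attained:
  "\<exists>D \<in> dense_subsets X. density X = |D| \<and> (\<forall>E \<in> dense_subsets X. |D| \<le>o |E| )"
proof -
  have ne: "card_of ` dense_subsets X \<noteq> {}"
    unfolding dense_subsets_def by (auto intro!: exI[of _ "topspace X"])
  obtain r where "r \<in> card_of ` dense_subsets X"
    and "\<forall>r' \<in> card_of ` dense_subsets X. r \<le>o r'"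
    using exists_minim_Card_order[OF ne] by (auto simp: card_of_Card_order)
  then have "\<exists>D. D \<in> dense_subsets X \<and> (\<forall>E \<in> dense_subsets X. |D| \<le>o |E| )"
    by auto
  from someI_ex[OF this] show ?thesis
    unfolding density_def by blast
qed

lemma is_card_sup_exists:
  fixes S :: "'a rel set"
  assumes "\<forall>s \<in> S. Card_order s"
  shows "\<exists>k. is_card_sup S k"
proof -
  let ?U = "{t :: 'a rel. Card_order t \<and> (\<forall>s \<in> S. s \<le>o t)}"
  have "s \<le>o |UNIV :: 'a set|" if "s \<in> S" for s
    using that assms card_of_mono1[OF subset_UNIV, of "Field s"]
      card_of_Field_ordIso[of s] ordIso_symmetric ordIso_ordLeq_trans by blast
  then have ne: "?U \<noteq> {}"
    using card_of_Card_order by blast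
  show ?thesis
    using exists_minim_Card_order[OF ne] unfolding is_card_sup_def by auto
qed

lemma is_card_sup_least:
  fixes S :: "'a rel set" and t :: "'b rel"
  assumes k: "is_card_sup S k" and t: "Card_order t" and ub: "\<forall>s \<in> S. s \<le>o t"
  shows "k \<le>o t"
proof (rule ccontr)
  have ck: "Card_order k"
    using k by (simp add: is_card_sup_def)
  assume nle: "\<not> k \<le>o t"
  then have "t \<le>o k"
    using ck t by (meson card_order_on_well_order_on ordLeq_total)
  then have "|Field t| \<le>o k"
    using card_of_Field_ordIso[OF t] ordIso_ordLeq_trans by blast
  then obtain A where A: "|Field t| =o |A :: 'a set|"
    using internalize_card_of_ordLeq[of "Field t" k] by blast
  then have tA: "t =o |A|"
    using card_of_Field_ordIso[OF t] ordIso_symmetric ordIso_transitive by blast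
  then have "\<forall>s \<in> S. s \<le>o |A|"
    using ub ordLeq_ordIso_trans by blast
  then have "k \<le>o |A|"
    using k card_of_Card_order unfolding is_card_sup_def by blast
  then show False
    using nle tA ordIso_symmetric ordLeq_ordIso_trans by blast
qed

end

theory Submission
  imports Defs
begin

text \<open>
  If the given cardinals have no maximum, a strictly increasing cofinal sequence of them is realised
  as \<open>|E n|\<close> with \<open>E n\<close> dense and of density \<open>|E n|\<close>.  It suffices to find disjoint open sets
  \<open>V i\<close> and indices \<open>m i\<close> such that for each \<open>k\<close> some \<open>E (m i) \<inter> V i\<close> has density at least
  \<open>|E k|\<close>: gluing these traces, and \<open>E 0\<close> off the \<open>V i\<close>, gives a dense set whose density is the
  supremum.  Call \<open>V\<close> bounded if some \<open>|E k|\<close> exceeds the density of every \<open>E m \<inter> V\<close>.  If some open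
  \<open>U\<close> has no bounded nonempty open subset, any infinite disjoint family of open subsets of \<open>U\<close>
  works.  Otherwise a maximal disjoint family of bounded open sets works: if all its members were
  bounded by one \<open>|E k|\<close>, then, having at most \<open>|E k|\<close> members, it would yield a dense subset of
  \<open>E (Suc k)\<close> of size at most \<open>|E k|\<close>.
\<close>

section \<open>Dense subsets and densities of subspaces\<close>

lemma dense_subsets_iff:
  "D \<in> dense_subsets X \<longleftrightarrow>
    D \<subseteq> topspace X \<and> (\<forall>U. openin X U \<and> U \<noteq> {} \<longrightarrow> D \<inter> U \<noteq> {})"
  unfolding dense_subsets_def mem_Collect_eq dense_intersects_open by (simp add: Int_commute)

lemma dense_subsets_subtopology_iff:
  assumes "A \<subseteq> topspace X"
  shows "B \<in> dense_subsets (subtopology X A) \<longleftrightarrow>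
    B \<subseteq> A \<and> (\<forall>U. openin X U \<and> A \<inter> U \<noteq> {} \<longrightarrow> B \<inter> U \<noteq> {})"
proof -
  have "topspace (subtopology X A) = A"
    using assms by auto
  then show ?thesis
    unfolding dense_subsets_iff openin_subtopology by (auto; blast)
qed

lemma dense_subsets_trans:
  assumes "D \<in> dense_subsets X" and "E \<in> dense_subsets (subtopology X D)"
  shows "E \<in> dense_subsets X"
proof -
  have D: "D \<subseteq> topspace X" "\<And>U. openin X U \<Longrightarrow> U \<noteq> {} \<Longrightarrow> D \<inter> U \<noteq> {}"
    using assms(1) unfolding dense_subsets_iff by metis+
  then have "E \<subseteq> D" "\<And>U. openin X U \<Longrightarrow> D \<inter> U \<noteq> {} \<Longrightarrow> E \<inter> U \<noteq> {}"
    using assms(2) dense_subsets_subtopology_iff[OF D(1)] by metis+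
  then show ?thesis
    unfolding dense_subsets_iff using D by (metis order_trans)
qed

lemma Card_order_density: "Card_order (density X)"
  using density_attained[of X] by (metis card_of_Card_order)

lemma density_le: "D \<in> dense_subsets X \<Longrightarrow> density X \<le>o |D|"
  using density_attained[of X] by metis

lemma density_subtopology_le_card:
  assumes "A \<subseteq> topspace X"
  shows "density (subtopology X A) \<le>o |A|"
  by (rule density_le) (simp add: dense_subsets_subtopology_iff[OF assms])

text \<open>A smallest dense subset of \<open>A\<close> meets every open set that meets
  \<open>A\<close>; as \<open>W\<close> is open, its trace on \<open>W\<close> is therefore dense in
  \<open>A \<inter> W\<close>.\<close>

lemma density_subtopology_Int_open:
  assumes A: "A \<subseteq> topspace X" and W: "openin X W"
  shows "density (subtopology X (A \<inter> W)) \<le>o density (subtopology X A)"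
proof -
  obtain B where B: "B \<in> dense_subsets (subtopology X A)"
    and dB: "density (subtopology X A) = |B|"
    using density_attained by blast
  have AW: "A \<inter> W \<subseteq> topspace X"
    using A by blast
  have "B \<inter> W \<in> dense_subsets (subtopology X (A \<inter> W))"
    using B unfolding dense_subsets_subtopology_iff[OF A] dense_subsets_subtopology_iff[OF AW]
    by (metis (no_types, lifting) Int_assoc Int_commute Int_mono W openin_Int subset_refl)
  then have "density (subtopology X (A \<inter> W)) \<le>o |B \<inter> W|"
    by (rule density_le)
  also have "|B \<inter> W| \<le>o |B|"
    by (simp add: card_of_mono1)
  finally (ordLeq_transitive) show ?thesis
    unfolding dB .
qed

section \<open>Crowded Hausdorff spaces\<close>

lemma infinite_dense_subset:
  assumes "crowded_space X" "Hausdorff_space X" "topspace X \<noteq> {}" and D: "D \<in> dense_subsets X"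
  shows "infinite D"
proof
  assume fin: "finite D"
  have T1: "t1_space X"
    using assms(2) by (rule Hausdorff_imp_t1_space)
  \<comment> \<open>Finite sets are closed in a T1 space, so \<open>D\<close> is the whole space;
    the same fact for \<open>D - {x}\<close> then isolates \<open>x\<close>.\<close>
  have "closedin X D"
    using T1 fin D t1_space_closedin_finite unfolding dense_subsets_iff by blast
  then have top: "topspace X = D"
    using D by (simp add: dense_subsets_def closure_of_closedin)
  obtain x where x: "x \<in> D"
    using assms(3) top by blast
  have "closedin X (D - {x})"
    using T1 fin top t1_space_closedin_finite by (metis Diff_subset finite_Diff)
  then have "openin X (topspace X - (D - {x}))"
    by blast
  moreover have "topspace X - (D - {x}) = {x}"
    using top x by blast
  ultimately show False
    using assms(1) x top unfolding crowded_space_def by metis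
qed

text \<open>No singleton is open, so \<open>W\<close> has two points; disjoint neighbourhoods of
  them are cut down to \<open>W\<close>.\<close>

lemma crowded_Hausdorff_split:
  assumes "crowded_space X" "Hausdorff_space X" and W: "openin X W" "W \<noteq> {}"
  obtains A B where "openin X A" "A \<noteq> {}" "A \<subseteq> W" "openin X B" "B \<noteq> {}" "B \<subseteq> W" "A \<inter> B = {}"
proof -
  obtain x where x: "x \<in> W"
    using W by blast
  have "x \<in> topspace X"
    using x W openin_subset by blast
  then have "W \<noteq> {x}"
    using assms(1) W unfolding crowded_space_def by metis
  then obtain y where y: "y \<in> W" "y \<noteq> x"
    using x by blast
  moreover have "y \<in> topspace X"
    using y W openin_subset by blast
  ultimately obtain A B where "openin X A" "openin X B" "x \<in> A" "y \<in> B" "disjnt A B"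
    using assms(2) \<open>x \<in> topspace X\<close> unfolding Hausdorff_space_def by metis
  then show ?thesis
    using that[of "A \<inter> W" "B \<inter> W"] x y W unfolding disjnt_iff by blast
qed

text \<open>Splitting is iterated: the first half of each pair is kept and the second is split
  again, so a kept half is disjoint from all later ones, which lie in its partner.\<close>

lemma crowded_Hausdorff_disjoint_sequence:
  assumes "crowded_space X" "Hausdorff_space X" and U: "openin X U" "U \<noteq> {}"
  obtains V :: "nat \<Rightarrow> 'a set" where "\<And>n. openin X (V n)" "\<And>n. V n \<noteq> {}" "\<And>n. V n \<subseteq> U"
    "disjoint_family V"
proof -
  let ?P = "\<lambda>p. openin X (fst p) \<and> fst p \<noteq> {} \<and> openin X (snd p) \<and> snd p \<noteq> {}
    \<and> fst p \<inter> snd p = {} \<and> fst p \<subseteq> U \<and> snd p \<subseteq> U"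
  have "\<exists>f. \<forall>n. ?P (f n) \<and> fst (f (Suc n)) \<union> snd (f (Suc n)) \<subseteq> snd (f n)"
  proof (rule dependent_nat_choice)
    show "\<exists>p. ?P p"
      using crowded_Hausdorff_split[OF assms] by (metis fst_conv snd_conv)
  next
    fix p n assume p: "?P p"
    then obtain A B where "openin X A" "A \<noteq> {}" "A \<subseteq> snd p" "openin X B" "B \<noteq> {}" "B \<subseteq> snd p"
      "A \<inter> B = {}"
      using crowded_Hausdorff_split[OF assms(1,2)] by metis
    then show "\<exists>q. ?P q \<and> fst q \<union> snd q \<subseteq> snd p"
      using p by (intro exI[of _ "(A, B)"]) auto
  qed
  then obtain f where Pf: "\<forall>n. ?P (f n) \<and> fst (f (Suc n)) \<union> snd (f (Suc n)) \<subseteq> snd (f n)"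
    by (rule exE)
  have f: "?P (f n)" and step: "fst (f (Suc n)) \<union> snd (f (Suc n)) \<subseteq> snd (f n)" for n
    using spec[OF Pf, of n] by simp_all
  have dec: "snd (f n) \<subseteq> snd (f m)" if "m \<le> n" for m n
    using that by (rule lift_Suc_antimono_le[rotated]) (use step in blast)
  have disj: "fst (f m) \<inter> fst (f n) = {}" if less: "m < n" for m n
  proof -
    obtain l where l: "n = Suc l" "m \<le> l"
      using less by (cases n) auto
    show ?thesis
      using step[of l] dec[OF l(2)] f[of m] l(1) by blast
  qed
  have "disjoint_family (\<lambda>n. fst (f n))"
    unfolding disjoint_family_on_def using disj by (metis Int_commute linorder_neqE_nat)
  then show ?thesis
    using that[of "\<lambda>n. fst (f n)"] f by blast
qed

section \<open>Gluing dense sets and disjoint open families\<close>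

lemma dense_glue:
  fixes E :: "nat \<Rightarrow> 'a set"
  assumes E: "\<And>n. E n \<in> dense_subsets X"
    and V: "\<And>i. i \<in> I \<Longrightarrow> openin X (V i)" and disj: "disjoint_family_on V I"
  obtains D where "D \<in> dense_subsets X" "D \<subseteq> (\<Union>n. E n)"
    "\<And>i. i \<in> I \<Longrightarrow> density (subtopology X (E (m i) \<inter> V i)) \<le>o density (subtopology X D)"
proof -
  \<comment> \<open>The part of \<open>E 0\<close> off all the \<open>V i\<close> takes care of open
    sets that miss every \<open>V i\<close>, so the union of the \<open>V i\<close> may fail to be
    dense.\<close>
  let ?D = "(\<Union>i\<in>I. E (m i) \<inter> V i) \<union> (E (0::nat) - (\<Union>i\<in>I. V i))"
  have top: "\<And>n. E n \<subseteq> topspace X"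
    and meet: "\<And>n U. openin X U \<Longrightarrow> U \<noteq> {} \<Longrightarrow> E n \<inter> U \<noteq> {}"
    using E unfolding dense_subsets_iff by blast+
  have Dtop: "?D \<subseteq> topspace X"
    using top by blast
  have "?D \<inter> U \<noteq> {}" if U: "openin X U" "U \<noteq> {}" for U
  proof (cases "\<exists>i\<in>I. V i \<inter> U \<noteq> {}")
    case True
    then obtain i where "i \<in> I" "V i \<inter> U \<noteq> {}" by blast
    then show ?thesis
      using meet[of "V i \<inter> U" "m i"] V U by blast
  next
    case False
    then show ?thesis
      using meet[OF U, of 0] by blast
  qed
  then have "?D \<in> dense_subsets X"
    using Dtop unfolding dense_subsets_iff by blast
  moreover have "density (subtopology X (E (m i) \<inter> V i)) \<le>o density (subtopology X ?D)"
    if i: "i \<in> I" for i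
  proof -
    \<comment> \<open>Disjointness makes the trace of the glued set on \<open>V i\<close> exactly
      that of \<open>E (m i)\<close>, and passing to an open trace does not raise the
      density.\<close>
    have "j = i" if "x \<in> V j" "x \<in> V i" "j \<in> I" for x j
      using disjoint_family_onD[OF disj \<open>j \<in> I\<close> i] that by blast
    then have eq: "?D \<inter> V i = E (m i) \<inter> V i"
      using i by auto
    show ?thesis
      using density_subtopology_Int_open[OF Dtop V[OF i]] by (simp only: eq)
  qed
  ultimately show ?thesis
    using that[of ?D] by blast
qed

text \<open>Zorn's lemma applies since disjointness of a family concerns two members at a time,
  which lie in one family of a chain. An admissible open set missing the union could be added to a
  maximal family.\<close>

lemma maximal_disjoint_open_family:
  obtains \<V> where "\<And>V. V \<in> \<V> \<Longrightarrow> openin X V \<and> V \<noteq> {} \<and> P V" "disjoint \<V>"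
    "\<And>V. openin X V \<Longrightarrow> V \<noteq> {} \<Longrightarrow> P V \<Longrightarrow> V \<inter> \<Union>\<V> \<noteq> {}"
proof -
  let ?F = "{\<V>. (\<forall>V\<in>\<V>. openin X V \<and> V \<noteq> {} \<and> P V) \<and> disjoint \<V>}"
  have "\<Union>\<C> \<in> ?F" if "\<C> \<in> chains ?F" for \<C>
  proof -
    have "disjoint (\<Union>\<C>)"
      by (rule pairwise_chain_Union) (use that in \<open>auto simp: chains_def\<close>)
    then show ?thesis
      using that unfolding chains_def by blast
  qed
  then have "\<exists>\<V>\<in>?F. \<forall>\<W>\<in>?F. \<V> \<subseteq> \<W> \<longrightarrow> \<W> = \<V>"
    by (intro Zorn_Lemma ballI)
  then obtain \<V> where \<V>: "\<V> \<in> ?F" and max: "\<forall>\<W>\<in>?F. \<V> \<subseteq> \<W> \<longrightarrow> \<W> = \<V>"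
    by (rule bexE)
  have "V \<inter> \<Union>\<V> \<noteq> {}" if V: "openin X V" "V \<noteq> {}" "P V" for V
  proof
    assume dis: "V \<inter> \<Union>\<V> = {}"
    then have ins: "insert V \<V> \<in> ?F"
      using \<V> V by (auto simp: pairwise_insert disjnt_def)
    have "insert V \<V> = \<V>"
      using bspec[OF max ins] by (simp add: subset_insertI)
    then have "V \<in> \<V>"
      by (metis insertI1)
    then show False
      using dis V(2) by (simp add: Sup_upper inf.absorb1)
  qed
  moreover have "disjoint \<V>" "\<And>V. V \<in> \<V> \<Longrightarrow> openin X V \<and> V \<noteq> {} \<and> P V"
    using \<V> by simp_all
  ultimately show ?thesis
    by (intro that)
qed

text \<open>Choosing a point of \<open>D\<close> in each member is injective by
  disjointness.\<close>

lemma card_disjoint_open_family_le_dense: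
  assumes D: "D \<in> dense_subsets X" and \<V>: "\<And>V. V \<in> \<V> \<Longrightarrow> openin X V \<and> V \<noteq> {}" "disjoint \<V>"
  shows "|\<V>| \<le>o |D|"
proof -
  have "\<forall>V\<in>\<V>. \<exists>x. x \<in> D \<inter> V"
    using D \<V> unfolding dense_subsets_iff by blast
  then obtain p where p: "\<And>V. V \<in> \<V> \<Longrightarrow> p V \<in> D \<inter> V"
    by metis
  then have "inj_on p \<V>"
    using \<V>(2) unfolding inj_on_def disjoint_def by (metis IntD2 IntI empty_iff)
  then show ?thesis
    using p by (metis IntD1 card_of_ordLeqI)
qed

section \<open>A dense set whose density dominates an increasing sequence\<close>

lemma dense_of_large_density:
  fixes E :: "nat \<Rightarrow> 'a set"
  assumes X: "crowded_space X" "Hausdorff_space X"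
    and E: "\<And>n. E n \<in> dense_subsets X"
    and dE: "\<And>n. |E n| \<le>o density (subtopology X (E n))"
    and less: "\<And>n. |E n| <o |E (Suc n)|"
  obtains D where "D \<in> dense_subsets X" "D \<subseteq> (\<Union>n. E n)"
    "\<And>n. |E n| \<le>o density (subtopology X D)"
proof -
  \<comment> \<open>Cardinals being totally ordered, the negation of \<open>big V k m\<close> says
    that \<open>E m \<inter> V\<close> has density strictly below \<open>|E k|\<close>.\<close>
  define big where "big V k m \<longleftrightarrow> |E k| \<le>o density (subtopology X (E m \<inter> V))" for V k m
  define bounded where "bounded V \<longleftrightarrow> (\<exists>k. \<forall>m. \<not> big V k m)" for V
  have mono: "|E k| \<le>o |E l|" if "k \<le> l" for k l
    using that
  proof (induction rule: dec_induct)
    case base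
    show ?case by (rule ordLeq_refl[OF card_of_Card_order])
  next
    case (step n)
    then show ?case using less[of n] ordLeq_ordLess_trans ordLess_imp_ordLeq by blast
  qed
  have top: "\<And>n. E n \<subseteq> topspace X"
    and meet: "\<And>n U. openin X U \<Longrightarrow> U \<noteq> {} \<Longrightarrow> E n \<inter> U \<noteq> {}"
    using E unfolding dense_subsets_iff by blast+
  \<comment> \<open>The larger side of a strict inequality is nonempty. Hence so is the space, and
    its dense subsets are infinite.\<close>
  have "E (Suc 0) \<noteq> {}"
    using less[of 0] by (metis card_of_empty not_ordLess_ordLeq)
  then have "topspace X \<noteq> {}"
    using top by blast
  then have inf: "infinite (E n)" for n
    using infinite_dense_subset[OF X] E by blast
  show ?thesis
  proof (cases "\<exists>U. openin X U \<and> U \<noteq> {} \<and>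
      (\<forall>V. openin X V \<and> V \<noteq> {} \<and> V \<subseteq> U \<longrightarrow> \<not> bounded V)")
    case True
    then obtain U where U: "openin X U" "U \<noteq> {}"
      and unbounded: "\<And>V. openin X V \<Longrightarrow> V \<noteq> {} \<Longrightarrow> V \<subseteq> U \<Longrightarrow> \<not> bounded V"
      by metis
    obtain V :: "nat \<Rightarrow> 'a set" where V: "\<And>n. openin X (V n)" "\<And>n. V n \<noteq> {}" "\<And>n. V n \<subseteq> U"
      "disjoint_family V"
      using crowded_Hausdorff_disjoint_sequence[OF X U] by blast
    \<comment> \<open>Unboundedness of \<open>V n\<close> is used only at the level
      \<open>n\<close>, so that the \<open>n\<close>th piece accounts for
      \<open>|E n|\<close>.\<close>
    have "\<exists>m. big (V n) n m" for n
      using unbounded[OF V(1-3)] unfolding bounded_def by blast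
    then obtain m where m: "\<And>n. big (V n) n (m n)"
      by metis
    obtain D where D: "D \<in> dense_subsets X" "D \<subseteq> (\<Union>n. E n)"
      and dD: "\<And>n. density (subtopology X (E (m n) \<inter> V n)) \<le>o density (subtopology X D)"
      using dense_glue[where E = E and I = UNIV and V = V and m = m, OF E V(1,4)]
      by (metis UNIV_I)
    have "|E n| \<le>o density (subtopology X D)" for n
      using m[of n] dD[of n] ordLeq_transitive unfolding big_def by blast
    then show ?thesis
      using that D by blast
  next
    case False
    obtain \<V> where \<V>: "\<And>V. V \<in> \<V> \<Longrightarrow> openin X V \<and> V \<noteq> {} \<and> bounded V" "disjoint \<V>"
      and maxV: "\<And>V. openin X V \<Longrightarrow> V \<noteq> {} \<Longrightarrow> bounded V \<Longrightarrow> V \<inter> \<Union>\<V> \<noteq> {}"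
      using maximal_disjoint_open_family[of X bounded] by blast
    have dense\<V>: "U \<inter> \<Union>\<V> \<noteq> {}" if U: "openin X U" "U \<noteq> {}" for U
    proof -
      obtain V where "openin X V" "V \<noteq> {}" "V \<subseteq> U" "bounded V"
        using False U by metis
      then show ?thesis
        using maxV by blast
    qed
    have large: "\<exists>V\<in>\<V>. \<exists>m. big V k m" for k
    proof (rule ccontr)
      assume nbig: "\<not> ?thesis"
      \<comment> \<open>The successor is taken so that a dense subset of \<open>E ?n\<close> of size
        at most \<open>|E k|\<close> is too small for the density of \<open>E ?n\<close>.\<close>
      let ?n = "Suc k"
      let ?Y = "\<lambda>V. subtopology X (E ?n \<inter> V)"
      have "\<exists>A. A \<in> dense_subsets (?Y V) \<and> |A| \<le>o |E k|" if "V \<in> \<V>" for V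
      proof -
        obtain A where A: "A \<in> dense_subsets (?Y V)" "density (?Y V) = |A|"
          using density_attained by blast
        have "\<not> |E k| \<le>o |A|"
          using nbig that A unfolding big_def by metis
        then show ?thesis
          using A card_of_Well_order ordLeq_total by blast
      qed
      then obtain A where A: "\<And>V. V \<in> \<V> \<Longrightarrow> A V \<in> dense_subsets (?Y V)"
        and cA: "\<And>V. V \<in> \<V> \<Longrightarrow> |A V| \<le>o |E k|"
        by metis
      have "|\<V>| \<le>o |E k|"
        using card_disjoint_open_family_le_dense[OF E] \<V> by blast
      \<comment> \<open>At most \<open>|E k|\<close> sets of size at most \<open>|E k|\<close> are
        united, and \<open>E k\<close> is infinite.\<close>
      then have "|\<Union>V\<in>\<V>. A V| \<le>o |E k|"
        using cA inf card_of_UNION_ordLeq_infinite by blast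
      moreover have "(\<Union>V\<in>\<V>. A V) \<in> dense_subsets (subtopology X (E ?n))"
      proof -
        have A': "A V \<subseteq> E ?n \<inter> V"
          "\<And>U. openin X U \<Longrightarrow> E ?n \<inter> V \<inter> U \<noteq> {} \<Longrightarrow> A V \<inter> U \<noteq> {}" if "V \<in> \<V>" for V
          using A[OF that] dense_subsets_subtopology_iff[of "E ?n \<inter> V" X "A V"] top by blast+
        \<comment> \<open>By maximality \<open>U\<close> meets some member \<open>V\<close>; the
          dense set \<open>E ?n\<close> meets the open set \<open>V \<inter> U\<close>, hence
          \<open>A V\<close> meets \<open>U\<close>.\<close>
        have "(\<Union>V\<in>\<V>. A V) \<inter> U \<noteq> {}" if U: "openin X U" "E ?n \<inter> U \<noteq> {}" for U
        proof -
          obtain V where V: "V \<in> \<V>" "U \<inter> V \<noteq> {}"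
            using dense\<V>[of U] U by blast
          then have "E ?n \<inter> (V \<inter> U) \<noteq> {}"
            using meet[of "V \<inter> U"] \<V> U by blast
          then show ?thesis
            using A'(2)[OF V(1) U(1)] V(1) by blast
        qed
        then show ?thesis
          unfolding dense_subsets_subtopology_iff[OF top] using A'(1) by blast
      qed
      ultimately have "|E ?n| \<le>o |E k|"
        using dE[of ?n] density_le ordLeq_transitive by blast
      then show False
        using less[of k] not_ordLess_ordLeq by blast
    qed
    \<comment> \<open>Gluing uses a single \<open>E m\<close> on \<open>V\<close>, so one
      \<open>m\<close> must serve all \<open>k\<close>. As \<open>V\<close> is bounded, there is a
      greatest \<open>k\<close> reached by some \<open>m\<close>, and this \<open>m\<close> serves
      all smaller \<open>k\<close> too; if no \<open>k\<close> is reached, any \<open>m\<close> will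
      do.\<close>
    have "\<exists>m. \<forall>k m'. big V k m' \<longrightarrow> big V k m" if V: "V \<in> \<V>" for V
    proof (cases "\<exists>k m. big V k m")
      case True
      obtain b where b: "\<And>m. \<not> big V b m"
        using \<V>(1)[OF V] unfolding bounded_def by blast
      have down: "big V k m" if "big V l m" "k \<le> l" for k l m
        using that mono ordLeq_transitive unfolding big_def by blast
      obtain k0 where k0: "\<exists>m. big V k0 m"
        using True by blast
      have "\<forall>l. (\<exists>m. big V l m) \<longrightarrow> l < b"
        using b down by (meson not_less)
      then obtain k m where "big V k m" "\<And>l m'. big V l m' \<Longrightarrow> l \<le> k"
        using ex_has_greatest_nat[of "\<lambda>k. \<exists>m. big V k m" k0 "\<lambda>k. k" b] k0 by blast
      then show ?thesis
        using down by blast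
    qed blast
    then obtain m where m: "\<And>V k m'. V \<in> \<V> \<Longrightarrow> big V k m' \<Longrightarrow> big V k (m V)"
      by metis
    have dis: "disjoint_family_on (\<lambda>V. V) \<V>"
      using \<V>(2) unfolding disjoint_family_on_def disjoint_def by blast
    obtain D where D: "D \<in> dense_subsets X" "D \<subseteq> (\<Union>n. E n)"
      and dD: "\<And>V. V \<in> \<V> \<Longrightarrow> density (subtopology X (E (m V) \<inter> V)) \<le>o density (subtopology X D)"
      by (rule dense_glue[where E = E and I = \<V> and V = "\<lambda>V. V" and m = m, OF E _ dis])
        (use \<V>(1) in blast, rule that)
    have "|E k| \<le>o density (subtopology X D)" for k
      using large[of k] m dD ordLeq_transitive unfolding big_def by blast
    then show ?thesis
      using that D by blast
  qed
qed

section \<open>Suprema of countable sets of densities\<close>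

lemma countable_cofinal_chain:
  fixes S :: "'a rel set"
  assumes S: "countable S" "S \<noteq> {}" and card: "\<And>s. s \<in> S \<Longrightarrow> Card_order s"
    and nomax: "\<And>s. s \<in> S \<Longrightarrow> \<exists>t\<in>S. \<not> t \<le>o s"
  obtains f :: "nat \<Rightarrow> 'a rel" where "\<And>n. f n \<in> S" "\<And>n. f n <o f (Suc n)"
    "\<And>s. s \<in> S \<Longrightarrow> \<exists>n. s \<le>o f n"
proof -
  let ?e = "from_nat_into S"
  have wo: "Well_order s" if "s \<in> S" for s
    using card[OF that] by (rule card_order_on_well_order_on)
  have up: "\<exists>t\<in>S. s <o t" if "s \<in> S" for s
    using nomax[OF that] wo that not_ordLeq_iff_ordLess by metis
  \<comment> \<open>Stage \<open>n\<close> passes strictly above both \<open>f n\<close> and the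
    \<open>n\<close>th entry of an enumeration of \<open>S\<close>; the first makes the sequence
    increase, the second makes it cofinal.\<close>
  have "\<exists>f. \<forall>n. f n \<in> S \<and> (f n <o f (Suc n) \<and> ?e n \<le>o f (Suc n))"
  proof (rule dependent_nat_choice)
    show "\<exists>s. s \<in> S"
      using S by blast
  next
    fix s n assume s: "s \<in> S"
    have e: "?e n \<in> S"
      using S(2) by (rule from_nat_into)
    obtain u where "u \<in> S" "s \<le>o u" "?e n \<le>o u"
      using s e wo ordLeq_total ordLeq_reflexive by metis
    then show "\<exists>t. t \<in> S \<and> s <o t \<and> ?e n \<le>o t"
      using up[of u] ordLeq_ordLess_trans ordLess_imp_ordLeq by blast
  qed
  then obtain f where f: "\<And>n. f n \<in> S" "\<And>n. f n <o f (Suc n)" "\<And>n. ?e n \<le>o f (Suc n)"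
    by blast
  have "\<exists>n. s \<le>o f n" if "s \<in> S" for s
    using f(3) from_nat_into_surj[OF S(1) that] by metis
  then show ?thesis
    using that[of f] f(1,2) by blast
qed

theorem theorem2p1:
  fixes X :: "'a topology"
  assumes "crowded_space X" and "Hausdorff_space X"
  shows "omega_closed (double_density_spectrum X)"
  unfolding omega_closed_def
proof (intro allI impI)
  let ?R = "double_density_spectrum X"
  fix S assume sub: "S \<subseteq> ?R" and S: "S \<noteq> {} \<and> countable S"
  \<comment> \<open>A smallest dense subset \<open>E\<close> of \<open>D\<close> has its own
    cardinality as density: a dense subset of \<open>E\<close> is dense in \<open>D\<close>, hence
    no smaller than \<open>E\<close>.\<close>
  have rep: "\<exists>E. s = |E| \<and> E \<in> dense_subsets X \<and> |E| \<le>o density (subtopology X E)"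
    if s: "s \<in> S" for s
  proof -
    obtain D where D: "D \<in> dense_subsets X" "s = density (subtopology X D)"
      using s sub unfolding double_density_spectrum_def by blast
    obtain E where E: "E \<in> dense_subsets (subtopology X D)" "s = |E|"
      and min: "\<forall>F \<in> dense_subsets (subtopology X D). |E| \<le>o |F|"
      using density_attained[of "subtopology X D"] D(2) by auto
    have ED: "E \<subseteq> D"
      using E(1) unfolding dense_subsets_def by auto
    obtain F where F: "F \<in> dense_subsets (subtopology X E)" "density (subtopology X E) = |F|"
      using density_attained by blast
    have "subtopology X E = subtopology (subtopology X D) E"
      using ED by (simp add: subtopology_subtopology inf.absorb2)
    then have "F \<in> dense_subsets (subtopology X D)"
      using E(1) F(1) dense_subsets_trans by metis
    then show ?thesis
      using E D(1) F(2) min dense_subsets_trans by metis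
  qed
  then have card: "\<And>s. s \<in> S \<Longrightarrow> Card_order s"
    by (metis card_of_Card_order)
  show "\<exists>k\<in>?R. is_card_sup S k"
  proof (cases "\<exists>k\<in>S. \<forall>s\<in>S. s \<le>o k")
    case True
    then show ?thesis
      using sub card unfolding is_card_sup_def by blast
  next
    case False
    obtain f :: "nat \<Rightarrow> 'a rel" where f: "\<And>n. f n \<in> S" "\<And>n. f n <o f (Suc n)"
      and cof: "\<And>s. s \<in> S \<Longrightarrow> \<exists>n. s \<le>o f n"
      using countable_cofinal_chain[of S] S card False by blast
    obtain E where E: "\<And>n. f n = |E n|" "\<And>n. E n \<in> dense_subsets X"
      "\<And>n. |E n| \<le>o density (subtopology X (E n))"
      using rep[OF f(1)] by metis
    obtain D where D: "D \<in> dense_subsets X" "D \<subseteq> (\<Union>n. E n)"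
      and large: "\<And>n. |E n| \<le>o density (subtopology X D)"
      using dense_of_large_density[OF assms, of E] E f(2) by metis
    let ?k = "density (subtopology X D)"
    \<comment> \<open>The inclusion of \<open>D\<close> in the countable union of the
      \<open>E n\<close> bounds its density, and \<open>t\<close>, infinite because
      \<open>E 0\<close> is, absorbs that union.\<close>
    have "?k \<le>o t" if t: "Card_order t" "\<forall>s\<in>S. s \<le>o t" for t :: "'a rel"
    proof -
      have Et: "|E n| \<le>o t" for n
        using t(2) f(1) E(1) by metis
      have "E (Suc 0) \<noteq> {}"
        using f(2)[of 0] E(1) by (metis card_of_empty not_ordLess_ordLeq)
      then have "infinite (E 0)"
        using infinite_dense_subset[OF assms] E(2) unfolding dense_subsets_iff by blast
      moreover have E0: "|E 0| \<le>o |Field t|"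
        using Et t(1) card_of_Field_ordIso ordIso_symmetric ordLeq_ordIso_trans by blast
      ultimately have inft: "infinite (Field t)"
        using card_of_ordLeq_infinite by blast
      have "|UNIV :: nat set| \<le>o t"
        using inft t(1) infinite_iff_card_of_nat card_of_Field_ordIso ordLeq_ordIso_trans by blast
      then have "|\<Union>n. E n| \<le>o t"
        using card_of_UNION_ordLeq_infinite_Field[OF inft t(1)] Et by blast
      moreover have "?k \<le>o |\<Union>n. E n|"
        using density_subtopology_le_card[of D X] D card_of_mono1[OF D(2)] ordLeq_transitive
        unfolding dense_subsets_iff by blast
      ultimately show ?thesis
        using ordLeq_transitive by blast
    qed
    moreover have "\<forall>s\<in>S. s \<le>o ?k"
      using cof large E(1) ordLeq_transitive by metis
    ultimately have "is_card_sup S ?k"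
      unfolding is_card_sup_def using Card_order_density by blast
    then show ?thesis
      using D(1) unfolding double_density_spectrum_def by blast
  qed
qed

end
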